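(* There exists an absolute constant $p>0$ such that for any fixed integer $s\ge3$, for all sufficiently large $n$ and any $t\in\left[R^{-1}(s,n)\log n,\ n\right]$, we have \[p\cdot \mathrm{RT}(s,t/\log n,n)\le g(n;s,t).\]
   Context: $R^{-1}(s,n)$ (the inverse Ramsey number) is the minimum independence number of a $K_s$-free graph on $n$ vertices. A red/blue/purple colouring of $K_n$ is a partition $R\cup B\cup P$ of its edge set. For integers $s,t\ge2$ and $n<R(s,t)$, $g(n;s,t)$ is the largest integer $g$ such that some red/blue/purple colouring of $K_n$ has $|P|=g$, $R\cup P$ is $K_s$-free and $B\cup P$ is $K_t$-free; for non-integer arguments $g(n;s,t):=g(n;\lceil s\rceil,\lceil t\rceil)$. $\mathrm{RT}(s,t,n)$ is the maximum number of edges in an $n$-vertex $K_s$-free graph with independence number less than $t$ (for real $t$). Logarithms are base 2. *)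

theory Defs
  imports Complex_Main "HOL-Library.Ramsey"
begin

text \<open>An \<open>n\<close>-vertex graph is represented by its edge set \<open>E \<subseteq> [{..<n}]\<^bsup>2\<^esup>\<close>.\<close>

definition clique_free :: "nat \<Rightarrow> nat \<Rightarrow> nat set set \<Rightarrow> bool" where
  "clique_free n s E \<longleftrightarrow> \<not> (\<exists>K\<in>[{..<n}]\<^bsup>s\<^esup>. clique K E)"

definition independence_number :: "nat \<Rightarrow> nat set set \<Rightarrow> nat" where
  "independence_number n E = Max {card S |S. S \<subseteq> {..<n} \<and> indep S E}"

definition inverse_Ramsey :: "nat \<Rightarrow> nat \<Rightarrow> nat" where
  "inverse_Ramsey s n =
     Min {independence_number n E |E. E \<subseteq> [{..<n}]\<^bsup>2\<^esup> \<and> clique_free n s E}"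

text \<open>If no graph is admissible, that is if \<open>t \<le> inverse_Ramsey s n\<close>, the maximum is taken
  to be \<open>0\<close>, which is the value of \<open>Sup {}\<close> on the naturals.\<close>

definition RT :: "nat \<Rightarrow> real \<Rightarrow> nat \<Rightarrow> nat" where
  "RT s t n =
     Sup {card E |E. E \<subseteq> [{..<n}]\<^bsup>2\<^esup> \<and> clique_free n s E \<and> real (independence_number n E) < t}"

definition rbp_colouring ::
    "nat \<Rightarrow> nat set set \<Rightarrow> nat set set \<Rightarrow> nat set set \<Rightarrow> bool" where
  "rbp_colouring n R B P \<longleftrightarrow>
     R \<union> B \<union> P = [{..<n}]\<^bsup>2\<^esup> \<and> R \<inter> B = {} \<and> R \<inter> P = {} \<and> B \<inter> P = {}"

text \<open>Meaningful only when \<open>n\<close> is less than the Ramsey number of \<open>s\<close> and \<open>t\<close>; otherwise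
  no colouring is admissible and \<open>Max\<close> is applied to the empty set.\<close>

definition g_int :: "nat \<Rightarrow> nat \<Rightarrow> nat \<Rightarrow> nat" where
  "g_int n s t =
     Max {card P |R B P. rbp_colouring n R B P
            \<and> clique_free n s (R \<union> P) \<and> clique_free n t (B \<union> P)}"

definition g :: "nat \<Rightarrow> real \<Rightarrow> real \<Rightarrow> nat" where
  "g n s t = g_int n (nat \<lceil>s\<rceil>) (nat \<lceil>t\<rceil>)"

end

theory Submission
  imports Defs
begin

text \<open>Let \<open>E\<close> be an extremal graph for \<open>RT s (t / log n) n\<close>. By a Turan-type bound every set of \<open>t\<close>
  vertices spans at least about \<open>t log n / 2\<close> edges of \<open>E\<close>. Colour the edges of \<open>E\<close> uniformly at
  random with 16 colours: a union bound over the at most \<open>n\<^sup>t\<close> vertex sets shows that, with positive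
  probability, no \<open>t\<close>-set spans a monochromatic subgraph of \<open>E\<close>. Make the most frequent
  colour class purple, the rest of \<open>E\<close> red and the complement of \<open>E\<close> blue.\<close>

section \<open>Independent sets and edge density\<close>

lemma card_indep_le_independence_number:
  assumes "I \<subseteq> {..<n}" "indep I E"
  shows "card I \<le> independence_number n E"
proof -
  have "finite (card ` Pow {..<n})" by simp
  then have "finite {card S |S. S \<subseteq> {..<n} \<and> indep S E}"
    by (rule rev_finite_subset) auto
  then show ?thesis
    unfolding independence_number_def using assms by (intro Max_ge) auto
qed

text \<open>An independent set maximal under inclusion dominates \<open>S\<close>: a vertex without
  a neighbour in it could be added. These neighbours supply the edges counted when such sets are
  peeled off.\<close>

lemma ex_maximal_indep:
  assumes "finite S"
  obtains I where "I \<subseteq> S" "indep I E" "\<And>v. v \<in> S - I \<Longrightarrow> \<exists>w\<in>I. {v, w} \<in> E"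
proof -
  let ?F = "{I. I \<subseteq> S \<and> indep I E}"
  have "finite ?F" using assms by simp
  moreover have "{} \<in> ?F" by (simp add: indep_def)
  ultimately have "\<exists>I\<in>?F. \<forall>J\<in>?F. I \<subseteq> J \<longrightarrow> I = J"
    by (intro finite_has_maximal) auto
  then obtain I where I: "I \<in> ?F" and max: "\<And>J. J \<in> ?F \<Longrightarrow> I \<subseteq> J \<Longrightarrow> I = J"
    by (elim bexE) blast
  have "\<exists>w\<in>I. {v, w} \<in> E" if v: "v \<in> S - I" for v
  proof (rule ccontr)
    assume "\<not> (\<exists>w\<in>I. {v, w} \<in> E)"
    then have "insert v I \<in> ?F"
      using I v by (auto simp: indep_def insert_commute)
    then have "I = insert v I" by (rule max) auto
    then show False using v by blast
  qed
  with I show ?thesis by (intro that[of I]) auto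
qed

text \<open>Peeling off maximal independent sets \<open>k\<close> times gives the tangent lines to the Turan bound
  \<open>(card S)\<^sup>2 / (2 a) - card S / 2\<close>.\<close>

lemma card_edges_lower_bound:
  assumes "finite S" "\<And>I. I \<subseteq> S \<Longrightarrow> indep I E \<Longrightarrow> card I \<le> a"
  shows "2 * k * card S \<le> 2 * card {e \<in> E. e \<subseteq> S} + a * k * (k + 1)"
  using assms
proof (induction k arbitrary: S)
  case 0
  then show ?case by simp
next
  case (Suc k)
  obtain I where I: "I \<subseteq> S" "indep I E" and nbr: "\<And>v. v \<in> S - I \<Longrightarrow> \<exists>w\<in>I. {v, w} \<in> E"
    using ex_maximal_indep[OF Suc.prems(1)] by blast
  obtain w where w: "\<And>v. v \<in> S - I \<Longrightarrow> w v \<in> I \<and> {v, w v} \<in> E"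
    using nbr by metis
  \<comment> \<open>One edge into \<open>I\<close> is picked for each vertex outside
    \<open>I\<close>. Such an edge has exactly one end outside \<open>I\<close>, so distinct
    vertices give distinct edges, and none of them lies inside \<open>S - I\<close>.\<close>
  define X where "X = (\<lambda>v. {v, w v}) ` (S - I)"
  have "inj_on (\<lambda>v. {v, w v}) (S - I)"
    using w by (intro inj_onI) (metis DiffD2 doubleton_eq_iff)
  then have cardX: "card X = card (S - I)"
    unfolding X_def by (rule card_image)
  have fin: "finite {e \<in> E. e \<subseteq> S}" "finite X" "finite {e \<in> E. e \<subseteq> S - I}" "finite I"
    using Suc.prems(1) I(1) by (auto simp: X_def intro: finite_subset)
  have "X \<union> {e \<in> E. e \<subseteq> S - I} \<subseteq> {e \<in> E. e \<subseteq> S}"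
    using w I(1) by (auto simp: X_def)
  moreover have "X \<inter> {e \<in> E. e \<subseteq> S - I} = {}"
    using w by (auto simp: X_def)
  ultimately have edges: "card (S - I) + card {e \<in> E. e \<subseteq> S - I} \<le> card {e \<in> E. e \<subseteq> S}"
    using fin cardX by (metis card_Un_disjoint card_mono)
  have IH: "2 * k * card (S - I) \<le> 2 * card {e \<in> E. e \<subseteq> S - I} + a * k * (k + 1)"
    using Suc.prems by (intro Suc.IH) auto
  have "card S = card (S - I) + card I"
    using I(1) Suc.prems(1) fin(4) by (metis card_Diff_subset card_mono le_add_diff_inverse2)
  \<comment> \<open>The error term grows by
    \<open>a * (k + 1) * (k + 2) - a * k * (k + 1) = 2 * (k + 1) * a\<close>, exactly the cost of
    removing at most \<open>a\<close> vertices.\<close>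
  then have "2 * Suc k * card S = 2 * card (S - I) + 2 * k * card (S - I) + 2 * Suc k * card I"
    by (simp add: algebra_simps)
  also have "\<dots> \<le> 2 * card (S - I) + (2 * card {e \<in> E. e \<subseteq> S - I} + a * k * (k + 1)) + 2 * Suc k * a"
    using IH Suc.prems(2)[OF I] by (intro add_mono mult_left_mono) auto
  also have "\<dots> \<le> 2 * card {e \<in> E. e \<subseteq> S} + a * k * (k + 1) + 2 * Suc k * a"
    using edges by linarith
  also have "\<dots> = 2 * card {e \<in> E. e \<subseteq> S} + a * Suc k * (Suc k + 1)"
    by (simp add: algebra_simps)
  finally show ?case .
qed

section \<open>Random edge colourings, by counting\<close>

lemma card_colourings_constant_on:
  fixes q :: nat
  assumes "finite E" "A \<subseteq> E"
  shows "card (PiE E (\<lambda>e. if e \<in> A then {c} else {..<q})) * q ^ card A = q ^ card E"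
proof -
  \<comment> \<open>Edges of \<open>A\<close> have one choice and all others \<open>q\<close>.
    Multiplying by \<open>q ^ card A\<close> expresses the probability \<open>q\<close> to the power
    \<open>- card A\<close> without division.\<close>
  have "card (PiE E (\<lambda>e. if e \<in> A then {c} else {..<q})) = (\<Prod>e\<in>E. if e \<in> A then 1 else q)"
    using assms(1) by (subst card_PiE) (auto intro: prod.cong)
  also have "\<dots> = q ^ card (E - A)"
    using assms(1) by (simp add: prod.If_cases Diff_eq)
  finally have "card (PiE E (\<lambda>e. if e \<in> A then {c} else {..<q})) * q ^ card A
      = q ^ (card (E - A) + card A)"
    by (simp add: power_add)
  also have "card (E - A) + card A = card E"
    using assms by (simp add: card_Diff_subset card_mono finite_subset)
  finally show ?thesis .
qed

text \<open>The union bound: a fixed set of the family has a fixed colour throughout with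
  probability at most \<open>1 / N\<close>, and there are \<open>q * card \<F> < N\<close> pairs of
  a set and a colour.\<close>

lemma ex_colouring_no_monochromatic:
  fixes q N :: nat
  assumes "finite E" "finite \<F>" "\<And>A. A \<in> \<F> \<Longrightarrow> A \<subseteq> E" "\<And>A. A \<in> \<F> \<Longrightarrow> N \<le> q ^ card A"
    and "q * card \<F> < N" "q > 0"
  obtains f where "f \<in> E \<rightarrow> {..<q}" "\<And>A c. A \<in> \<F> \<Longrightarrow> c < q \<Longrightarrow> \<exists>e\<in>A. f e \<noteq> c"
proof -
  define bad where "bad A c = PiE E (\<lambda>e. if e \<in> A then {c} else {..<q})" for A and c :: nat
  let ?I = "\<F> \<times> {..<q}"
  let ?U = "\<Union>(A, c)\<in>?I. bad A c"
  have "finite (bad A c)" for A c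
    unfolding bad_def using assms(1) by (intro finite_PiE) auto
  then have fin: "finite ?U" using assms(2) by auto
  have "card ?U * N \<le> (\<Sum>(A, c)\<in>?I. card (bad A c)) * N"
    using assms(2) card_UN_le[of ?I "\<lambda>(A, c). bad A c"]
    by (intro mult_right_mono) (auto simp: case_prod_unfold)
  also have "\<dots> = (\<Sum>(A, c)\<in>?I. card (bad A c) * N)"
    by (simp add: sum_distrib_right case_prod_unfold)
  also have "\<dots> \<le> (\<Sum>(A, c)\<in>?I. q ^ card E)"
  proof (intro sum_mono, clarify)
    fix A c assume A: "A \<in> \<F>"
    have "card (bad A c) * N \<le> card (bad A c) * q ^ card A"
      using assms(4)[OF A] by (rule mult_left_mono) simp
    also have "\<dots> = q ^ card E"
      unfolding bad_def by (rule card_colourings_constant_on[OF assms(1) assms(3)[OF A]])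
    finally show "card (bad A c) * N \<le> q ^ card E" .
  qed
  also have "\<dots> = (q * card \<F>) * q ^ card E"
    by (simp add: case_prod_unfold card_cartesian_product)
  also have "\<dots> < N * q ^ card E"
    using assms(5,6) by (intro mult_strict_right_mono) auto
  also have "\<dots> = card (PiE E (\<lambda>_. {..<q})) * N"
    using assms(1) by (simp add: card_PiE)
  finally have "card ?U < card (PiE E (\<lambda>_. {..<q}))" by simp
  then have "\<not> PiE E (\<lambda>_. {..<q}) \<subseteq> ?U"
    using card_mono[OF fin] by (metis not_le)
  then obtain f where f: "f \<in> PiE E (\<lambda>_. {..<q})" "f \<notin> ?U" by blast
  show ?thesis
  proof
    show "f \<in> E \<rightarrow> {..<q}" using f(1) by (auto simp: PiE_def)
    show "\<exists>e\<in>A. f e \<noteq> c" if "A \<in> \<F>" "c < q" for A c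
    proof (rule ccontr)
      assume "\<not> (\<exists>e\<in>A. f e \<noteq> c)"
      then have "f \<in> bad A c"
        using f(1) by (auto simp: bad_def PiE_iff)
      then show False using f(2) that by blast
    qed
  qed
qed

lemma ex_large_colour_class:
  fixes q :: nat
  assumes "finite E" "f \<in> E \<rightarrow> {..<q}" "q > 0"
  shows "\<exists>c<q. card E \<le> q * card {e \<in> E. f e = c}"
proof (rule ccontr)
  assume "\<not> ?thesis"
  then have small: "q * card {e \<in> E. f e = c} < card E" if "c < q" for c
    using that by (meson not_le)
  have "E = (\<Union>c<q. {e \<in> E. f e = c})" using assms(2) by auto
  then have "q * card E \<le> q * (\<Sum>c<q. card {e \<in> E. f e = c})"
    using card_UN_le[of "{..<q}" "\<lambda>c. {e \<in> E. f e = c}"] by simp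
  also have "\<dots> = (\<Sum>c<q. q * card {e \<in> E. f e = c})"
    by (rule sum_distrib_left)
  also have "\<dots> < (\<Sum>c<q. card E)"
    using small assms(3) by (intro sum_strict_mono) auto
  finally show False by simp
qed

section \<open>The extremal quantities as maxima of finite sets\<close>

lemma finite_all_edges: "finite ([{..<n::nat}]\<^bsup>2\<^esup>)"
  by (simp add: finite_imp_finite_nsets)

lemma RT_attained:
  assumes "RT s t n \<noteq> 0"
  obtains E where "E \<subseteq> [{..<n}]\<^bsup>2\<^esup>" "clique_free n s E" "real (independence_number n E) < t"
    "card E = RT s t n"
proof -
  let ?A = "{card E |E. E \<subseteq> [{..<n}]\<^bsup>2\<^esup> \<and> clique_free n s E \<and> real (independence_number n E) < t}"
  have "finite (card ` Pow ([{..<n}]\<^bsup>2\<^esup>))" by (simp add: finite_all_edges)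
  then have fin: "finite ?A" by (rule rev_finite_subset) auto
  have RT: "RT s t n = Sup ?A" by (simp add: RT_def)
  \<comment> \<open>A nonzero value rules out the default \<open>Sup {} = 0\<close>; the supremum of
    a finite nonempty set of naturals is its maximum.\<close>
  then have "?A \<noteq> {}" using assms by (auto simp: Sup_nat_def simp del: Collect_empty_eq)
  then have "Sup ?A \<in> ?A" using fin Max_in unfolding Sup_nat_def by (metis (no_types, lifting))
  then show ?thesis using that RT by auto
qed

text \<open>The colouring supplied witnesses that the set under \<open>Max\<close> is nonempty, so
  the value of \<open>g_int\<close> is a genuine maximum here.\<close>

lemma card_le_g_int:
  assumes "rbp_colouring n R B P" "clique_free n s (R \<union> P)" "clique_free n t (B \<union> P)"
  shows "card P \<le> g_int n s t"
proof -
  have "finite (card ` Pow ([{..<n}]\<^bsup>2\<^esup>))" by (simp add: finite_all_edges)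
  then have "finite {card P |R B P. rbp_colouring n R B P
            \<and> clique_free n s (R \<union> P) \<and> clique_free n t (B \<union> P)}"
    by (rule rev_finite_subset) (auto simp: rbp_colouring_def)
  then show ?thesis
    unfolding g_int_def using assms by (intro Max_ge) auto
qed

section \<open>The inequality for integer parameters\<close>

lemma card_le_g_int_of_sparse_indep:
  fixes n m s L :: nat
  assumes E: "E \<subseteq> [{..<n}]\<^bsup>2\<^esup>" "clique_free n s E"
    and L: "7 \<le> L" "n < 2 ^ (L + 1)"
    and m: "0 < m" "independence_number n E * L \<le> m"
  shows "card E \<le> 16 * g_int n s m"
proof -
  \<comment> \<open>In the application \<open>L\<close> is the integer part of
    \<open>log 2 n\<close> and \<open>m\<close> is \<open>t\<close> rounded up.\<close>
  define a where "a = independence_number n E"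
  define inside where "inside S = {e \<in> E. e \<subseteq> S}" for S
  define \<F> where "\<F> = inside ` ([{..<n}]\<^bsup>m\<^esup>)"
  have finE: "finite E" using E(1) finite_all_edges finite_subset by blast
  have fin: "finite ([{..<n}]\<^bsup>m\<^esup>)" by (simp add: finite_imp_finite_nsets)
  \<comment> \<open>The tangent line is taken at \<open>k = L\<close>. Since
    \<open>a * L \<le> m\<close>, its error is at most \<open>m * (L + 1)\<close>, which leaves
    \<open>2 * card A \<ge> m * (L - 1)\<close>; finally \<open>16 = 4 ^ 2\<close>.\<close>
  have dense: "4 ^ (m * (L - 1)) \<le> (16::nat) ^ card A" if "A \<in> \<F>" for A
  proof -
    obtain S where S: "S \<subseteq> {..<n}" "card S = m" "finite S" "A = inside S"
      using \<open>A \<in> \<F>\<close> by (auto simp: \<F>_def nsets_def)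
    have "2 * L * card S \<le> 2 * card {e \<in> E. e \<subseteq> S} + a * L * (L + 1)"
      using S unfolding a_def
      by (intro card_edges_lower_bound card_indep_le_independence_number) auto
    then have "2 * L * m \<le> 2 * card A + a * L * (L + 1)"
      using S by (simp add: inside_def)
    also have "\<dots> \<le> 2 * card A + m * (L + 1)"
      using m(2) unfolding a_def by (intro add_left_mono mult_right_mono) auto
    finally have "m * (L - 1) \<le> 2 * card A"
      by (simp add: algebra_simps diff_mult_distrib2)
    then have "(4::nat) ^ (m * (L - 1)) \<le> 4 ^ (2 * card A)"
      by (intro power_increasing) auto
    then show ?thesis by (simp add: power_mult)
  qed
  have few: "16 * card \<F> < 4 ^ (m * (L - 1))"
  proof -
    have "card \<F> \<le> n choose m"
      unfolding \<F>_def using card_image_le[OF fin] by (simp add: card_nsets)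
    also have "\<dots> \<le> n ^ m"
    proof (cases "m \<le> n")
      case True
      then show ?thesis by (rule binomial_le_pow)
    qed (simp add: binomial_eq_0)
    also have "\<dots> < (2 ^ (L + 1)) ^ m"
      using L(2) m(1) by (intro power_strict_mono) auto
    finally have "16 * card \<F> < 2 ^ 4 * (2 ^ (L + 1)) ^ m" by simp
    also have "\<dots> = 2 ^ (4 + m * (L + 1))"
      by (simp add: power_add power_mult mult.commute flip: power_mult)
    also have "\<dots> \<le> 2 ^ (2 * (m * (L - 1)))"
    proof -
      \<comment> \<open>The exponents compare once \<open>4 \<le> m * (L - 3)\<close>; for
        \<open>m = 1\<close> this is precisely \<open>7 \<le> L\<close>.\<close>
      obtain j where j: "L = j + 7" using L(1) by (metis add.commute le_Suc_ex)
      obtain i where i: "m = Suc i" using m(1) gr0_implies_Suc by blast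
      have "4 + m * (L + 1) \<le> 2 * (m * (L - 1))"
        unfolding i j by (simp add: algebra_simps)
      then show ?thesis by (intro power_increasing) auto
    qed
    also have "\<dots> = 4 ^ (m * (L - 1))" by (simp add: power_mult)
    finally show ?thesis .
  qed
  obtain f where f: "f \<in> E \<rightarrow> {..<16::nat}"
    and no_mono: "\<And>A c. A \<in> \<F> \<Longrightarrow> c < 16 \<Longrightarrow> \<exists>e\<in>A. f e \<noteq> c"
  proof (rule ex_colouring_no_monochromatic[OF finE _ _ dense few])
    show "finite \<F>" using fin by (simp add: \<F>_def)
    show "A \<subseteq> E" if "A \<in> \<F>" for A using that by (auto simp: \<F>_def inside_def)
  qed auto
  obtain c where c: "c < 16" "card E \<le> 16 * card {e \<in> E. f e = c}"
    using ex_large_colour_class[OF finE f] by auto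
  define P where "P = {e \<in> E. f e = c}"
  have "card P \<le> g_int n s m"
  proof (rule card_le_g_int)
    show "rbp_colouring n (E - P) ([{..<n}]\<^bsup>2\<^esup> - E) P"
      using E(1) by (auto simp: rbp_colouring_def P_def)
    have "E - P \<union> P = E" by (auto simp: P_def)
    then show "clique_free n s (E - P \<union> P)" using E(2) by simp
    \<comment> \<open>In a clique on \<open>m\<close> vertices every edge of \<open>E\<close> would
      lie in \<open>P\<close>, hence have colour \<open>c\<close>, but each \<open>m\<close>-set
      spans an edge of \<open>E\<close> of another colour.\<close>
    show "clique_free n m ([{..<n}]\<^bsup>2\<^esup> - E \<union> P)"
      unfolding clique_free_def
    proof
      assume "\<exists>K\<in>[{..<n}]\<^bsup>m\<^esup>. clique K ([{..<n}]\<^bsup>2\<^esup> - E \<union> P)"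
      then obtain K where K: "K \<in> [{..<n}]\<^bsup>m\<^esup>" "clique K ([{..<n}]\<^bsup>2\<^esup> - E \<union> P)" by blast
      then have "inside K \<in> \<F>" by (simp add: \<F>_def)
      then obtain e where e: "e \<in> E" "e \<subseteq> K" "f e \<noteq> c"
        using no_mono c(1) by (fastforce simp: inside_def)
      then obtain v w where "e = {v, w}" "v \<noteq> w"
        using E(1) by (auto simp: nsets_def card_2_iff)
      then have "e \<in> [{..<n}]\<^bsup>2\<^esup> - E \<union> P"
        using K(2) e(2) by (auto simp: clique_def)
      then show False using e by (simp add: P_def)
    qed
  qed
  then show ?thesis using c(2) by (simp add: P_def)
qed

section \<open>Passage to real \<open>t\<close> and logarithms\<close>

theorem theorem1p6:
  shows "\<exists>p::real. p > 0 \<and>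
    (\<forall>s::nat. s \<ge> 3 \<longrightarrow>
      (\<forall>\<^sub>F n::nat in sequentially.
        \<forall>t::real \<in> {real (inverse_Ramsey s n) * log 2 (real n) .. real n}.
          p * real (RT s (t / log 2 (real n)) n) \<le> real (g n (real s) t)))"
proof (intro exI[of _ "1 / 16"] conjI allI impI)
  fix s :: nat
  \<comment> \<open>The factor 16 is the number of colours, and \<open>128 = 2 ^ 7\<close> ensures
    \<open>7 \<le> L\<close>; the threshold is the same for every \<open>s\<close>.\<close>
  have main: "real (RT s (t / log 2 (real n)) n) \<le> 16 * real (g n (real s) t)"
    if n: "n \<ge> 128" for n :: nat and t :: real
  proof (cases "RT s (t / log 2 (real n)) n = 0")
    case False
    define L where "L = nat \<lfloor>log 2 (real n)\<rfloor>"
    have "log 2 (2 ^ 7) \<le> log 2 (real n)"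
      using n by (subst log_le_cancel_iff) auto
    then have log7: "7 \<le> log 2 (real n)" by (subst (asm) log_pow_cancel) auto
    then have L7: "7 \<le> L" unfolding L_def by linarith
    have L_le: "real L \<le> log 2 (real n)" and "log 2 (real n) < real (L + 1)"
      unfolding L_def using log7 by linarith+
    then have "real n < 2 powr real (L + 1)"
      using n by (subst (asm) log_less_iff) auto
    then have "real n < real (2 ^ (L + 1))"
      by (subst (asm) powr_realpow) auto
    then have n_less: "n < 2 ^ (L + 1)" by linarith
    obtain E where E: "E \<subseteq> [{..<n}]\<^bsup>2\<^esup>" "clique_free n s E"
      and indep: "real (independence_number n E) < t / log 2 (real n)"
      and cardE: "card E = RT s (t / log 2 (real n)) n"
      using RT_attained[OF False] by blast
    \<comment> \<open>The strict bound in \<open>RT\<close> forces \<open>t > 0\<close>, so rounding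
      up gives a positive integer. Rounding \<open>log 2 n\<close> down and \<open>t\<close> up both
      preserve the inequality.\<close>
    have lt: "real (independence_number n E) * log 2 (real n) < t"
      using indep log7 by (simp add: pos_less_divide_eq)
    moreover have "0 \<le> real (independence_number n E) * log 2 (real n)"
      using log7 by simp
    ultimately have "0 < t" by linarith
    then have m_pos: "0 < nat \<lceil>t\<rceil>" by simp
    have "real (independence_number n E) * real L \<le> real (independence_number n E) * log 2 (real n)"
      using L_le by (rule mult_left_mono) simp
    then have "real (independence_number n E * L) \<le> real (nat \<lceil>t\<rceil>)"
      using lt by (simp, linarith)
    then have "independence_number n E * L \<le> nat \<lceil>t\<rceil>" by linarith
    then have "card E \<le> 16 * g_int n s (nat \<lceil>t\<rceil>)"
      using card_le_g_int_of_sparse_indep[OF E L7 n_less m_pos] by simp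
    then show ?thesis by (simp add: cardE g_def)
  qed simp
  show "\<forall>\<^sub>F n::nat in sequentially.
        \<forall>t::real \<in> {real (inverse_Ramsey s n) * log 2 (real n) .. real n}.
          1 / 16 * real (RT s (t / log 2 (real n)) n) \<le> real (g n (real s) t)"
    using eventually_ge_at_top[of 128] by (rule eventually_mono) (use main in \<open>auto simp: field_simps\<close>)
qed simp

end
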